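(* Let $N_r\ge 2$ be an integer, let $\Theta\in\mathbb{R}$, and let $\mathbf v(\Theta)=[1,e^{\mathrm j\Theta},\dots,e^{\mathrm j(N_r-1)\Theta}]^T\in\mathbb{C}^{N_r}$. Consider the optimization problem $$\max_{\mathbf S}\ \operatorname{rank}(\mathbf S)\quad\text{subject to}\quad \mathbf S\,\mathbf v(\Theta)=\mathbf 0,\qquad |[\mathbf S]_{m,n}|=1\ \ \forall m,n,$$ over complex matrices $\mathbf S$ with $N_r$ columns and full row rank. Let $\mathbf F$ be the $(N_r-1)\times N_r$ truncated Fourier matrix and $\mathbf R=\operatorname{diag}(1,e^{-\mathrm j\Theta},\dots,e^{-\mathrm j(N_r-1)\Theta})$ the phase compensation matrix. Then $$\mathbf S_F=\mathbf F\mathbf R,$$ that is, the $(N_r-1)\times N_r$ matrix with entries $w^{mn}z^{n}$ for $m=1,\dots,N_r-1$ and $n=0,\dots,N_r-1$, where $w=e^{-\mathrm j2\pi/N_r}$ and $z=e^{-\mathrm j\Theta}$, is a solution (a maximizer) of this problem.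
   Context: $\mathrm j$ denotes the imaginary unit. The truncated Fourier matrix $\mathbf F\in\mathbb{C}^{(N_r-1)\times N_r}$ is the $N_r\times N_r$ Fourier matrix $[w^{mn}]_{0\le m,n\le N_r-1}$, $w=e^{-\mathrm j2\pi/N_r}$, with its first (all-one) row $m=0$ removed. The number of rows of $\mathbf S$ is not fixed in advance: it equals its rank. *)

theory Defs
  imports Complex_Main "Jordan_Normal_Form.DL_Rank"
begin

definition mat_rank :: "'a::field mat \<Rightarrow> nat" where
  "mat_rank A = vec_space.rank (dim_row A) A"

definition steering_vec :: "nat \<Rightarrow> real \<Rightarrow> complex vec" where
  "steering_vec N \<theta> = vec N (\<lambda>n. exp (\<i> * of_nat n * of_real \<theta>))"

definition fourier_root :: "nat \<Rightarrow> complex" where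
  "fourier_root N = exp (- (\<i> * 2 * of_real pi / of_nat N))"

definition fourier_mat :: "nat \<Rightarrow> complex mat" where
  "fourier_mat N = mat N N (\<lambda>(m, n). fourier_root N ^ (m * n))"

(* Row index i of the truncated matrix is row i + 1 of the full matrix. *)
definition truncated_fourier_mat :: "nat \<Rightarrow> complex mat" where
  "truncated_fourier_mat N = mat (N - 1) N (\<lambda>(i, n). fourier_mat N $$ (i + 1, n))"

definition phase_comp_mat :: "nat \<Rightarrow> real \<Rightarrow> complex mat" where
  "phase_comp_mat N \<theta> = mat_diag N (\<lambda>n. exp (- (\<i> * of_nat n * of_real \<theta>)))"

(* The number of rows of S is left free; full row rank ties it to the rank. *)
definition feasible :: "nat \<Rightarrow> real \<Rightarrow> complex mat \<Rightarrow> bool" where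
  "feasible N \<theta> S \<longleftrightarrow>
     dim_col S = N \<and>
     mat_rank S = dim_row S \<and>
     S *\<^sub>v steering_vec N \<theta> = 0\<^sub>v (dim_row S) \<and>
     (\<forall>m < dim_row S. \<forall>n < N. cmod (S $$ (m, n)) = 1)"

end

(* Every matrix annihilating a nonzero vector of length N has rank less than N, so N - 1 bounds the
   objective. The geometric sums over the N-th roots of unity show both that S_F annihilates the
   steering vector and that its conjugate transpose divided by N is a right inverse, so S_F attains
   the bound. *)
theory Submission
  imports Defs
begin

text \<open>Linear dependence concerns the set of columns, which forgets repetitions. For distinct
  columns the kernel vector is a nontrivial relation among them, which excludes rank
  \<open>nc\<close>; a repeated column already leaves fewer than \<open>nc\<close> vectors in the
  set.\<close>

lemma (in vec_space) rank_less_if_kernel_nonzero: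
  assumes A: "A \<in> carrier_mat n nc"
    and v: "v \<in> carrier_vec nc" "v \<noteq> 0\<^sub>v nc" "A *\<^sub>v v = 0\<^sub>v n"
  shows "rank A < nc"
proof (cases "distinct (cols A)")
  case True
  then show ?thesis
    using lin_depI[OF A v] full_rank_lin_indpt[OF A] rank_le_nc[OF A] by fastforce
next
  case False
  \<comment> \<open>The rank is the size of any maximal independent subset of the columns.\<close>
  obtain S where S: "maximal S (\<lambda>T. T \<subseteq> set (cols A) \<and> lin_indpt T)"
    using maximal_exists_superset[of "set (cols A)" "\<lambda>T. T \<subseteq> set (cols A) \<and> lin_indpt T" "{}"]
    by (metis List.finite_set empty_subsetI finite_lin_indpt2 finite.emptyI empty_iff)
  then have "card S \<le> card (set (cols A))"
    by (simp add: card_mono maximal_def)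
  also have "\<dots> < length (cols A)"
    using False card_distinct card_length le_neq_implies_less by blast
  finally show ?thesis
    using rank_card_indpt[OF A S] A by simp
qed

text \<open>Every \<open>y\<close> equals \<open>A\<close> applied to \<open>B *\<^sub>v y\<close>,
  so the columns span the whole space, whose dimension is \<open>n\<close>.\<close>

lemma (in vec_space) rank_eq_n_if_right_inverse:
  assumes A: "A \<in> carrier_mat n nc" and B: "B \<in> carrier_mat nc n" and AB: "A * B = 1\<^sub>m n"
  shows "rank A = n"
proof -
  have "y \<in> col_space A" if y: "y \<in> carrier_vec n" for y
  proof -
    have "A *\<^sub>v (B *\<^sub>v y) = y"
      using A B y AB by (metis assoc_mult_mat_vec one_mult_mat_vec)
    then show ?thesis
      unfolding col_space_eq[OF A] using A B y by fastforce
  qed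
  then have "span (set (cols A)) = carrier_vec n"
    using A col_space_eq[OF A] unfolding col_space_def by auto
  moreover have "vs (carrier_vec n) = V"
    by (simp add: module_vec_def)
  ultimately show ?thesis
    unfolding rank_def by (simp only: dim_is_n)
qed

lemma geometric_sum_root_of_unity:
  fixes x :: "'a::field"
  assumes "x ^ N = 1" "x \<noteq> 1"
  shows "(\<Sum>n<N. x ^ n) = 0"
  using assms by (simp add: geometric_sum)

text \<open>The angle has the shape used in \<open>bij_betw_roots_unity\<close>; the inverse
  accounts for the negative sign in the exponent of \<open>fourier_root\<close>.\<close>

lemma fourier_root_power_eq: "fourier_root N ^ k = inverse (cis (2 * pi * real k / real N))"
proof -
  have "fourier_root N ^ k = exp (of_nat k * - (\<i> * 2 * of_real pi / of_nat N))"
    unfolding fourier_root_def by (rule exp_of_nat_mult[symmetric])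
  also have "\<dots> = exp (- (\<i> * of_real (2 * pi * real k / real N)))"
    by (simp add: mult_ac)
  finally show ?thesis
    by (simp add: cis_conv_exp exp_minus)
qed

lemma fourier_root_nonzero: "fourier_root N \<noteq> 0"
  by (simp add: fourier_root_def)

lemma cmod_fourier_root: "cmod (fourier_root N) = 1"
  using fourier_root_power_eq[of N 1] by (simp add: norm_inverse)

lemma fourier_root_power_power_self:
  assumes "N > 0"
  shows "(fourier_root N ^ k) ^ N = 1"
proof -
  have "fourier_root N ^ N = 1"
    using assms by (simp add: fourier_root_power_eq)
  then show ?thesis
    by (metis power_mult mult.commute power_one)
qed

text \<open>The powers are the inverses of the \<open>N\<close> distinct roots of unity, and
  inversion is injective.\<close>

lemma inj_on_fourier_root_power:
  assumes "N > 0"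
  shows "inj_on (\<lambda>k. fourier_root N ^ k) {..<N}"
  using bij_betw_imp_inj_on[OF bij_betw_roots_unity[OF assms]]
  by (auto simp: inj_on_def fourier_root_power_eq simp del: cis_inverse)

text \<open>The closed form of the product \<open>F R\<close>, from which kernel and rank are
  computed entrywise. The shift \<open>i + 1\<close> reflects the removed all-one row.\<close>

definition compensated_fourier_mat :: "nat \<Rightarrow> real \<Rightarrow> complex mat" where
  "compensated_fourier_mat N \<theta> =
     mat (N - 1) N (\<lambda>(i, n). fourier_root N ^ ((i + 1) * n) * exp (- (\<i> * of_real \<theta>)) ^ n)"

lemma compensated_fourier_mat_carrier: "compensated_fourier_mat N \<theta> \<in> carrier_mat (N - 1) N"
  by (simp add: compensated_fourier_mat_def)

text \<open>Right multiplication by a diagonal matrix scales column \<open>n\<close> by its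
  \<open>n\<close>-th diagonal entry, here a power of a single phase.\<close>

lemma truncated_fourier_mult_phase_comp:
  "truncated_fourier_mat N * phase_comp_mat N \<theta> = compensated_fourier_mat N \<theta>"
proof -
  have "exp (- (\<i> * of_nat n * of_real \<theta>)) = exp (- (\<i> * of_real \<theta>)) ^ n" for n
    by (simp add: exp_of_nat_mult[symmetric] mult_ac)
  moreover have "truncated_fourier_mat N \<in> carrier_mat (N - 1) N"
    by (simp add: truncated_fourier_mat_def)
  ultimately show ?thesis
    unfolding phase_comp_mat_def compensated_fourier_mat_def
    by (subst mat_diag_mult_right[of _ "N - 1"])
      (auto intro!: eq_matI simp: truncated_fourier_mat_def fourier_mat_def)
qed

text \<open>The compensating phases cancel the steering vector entry by entry, which leaves a full
  geometric sum over a root of unity in each row.\<close>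

lemma compensated_fourier_mult_steering:
  "compensated_fourier_mat N \<theta> *\<^sub>v steering_vec N \<theta> = 0\<^sub>v (N - 1)"
proof (rule eq_vecI)
  fix i assume "i < dim_vec (0\<^sub>v (N - 1) :: complex vec)"
  then have i: "i < N - 1" by simp
  have cancel: "exp (- (\<i> * of_real \<theta>)) ^ n * exp (\<i> * of_nat n * of_real \<theta>) = 1" for n
    by (simp add: exp_of_nat_mult[symmetric] exp_add[symmetric] mult_ac)
  have "(compensated_fourier_mat N \<theta> *\<^sub>v steering_vec N \<theta>) $ i =
      (\<Sum>n<N. (fourier_root N ^ (i + 1)) ^ n)"
    unfolding power_mult[symmetric] using i
    by (simp add: compensated_fourier_mat_def steering_vec_def scalar_prod_def
        mult.assoc cancel[unfolded mult.assoc] lessThan_atLeast0)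
  also have "\<dots> = 0"
  proof (rule geometric_sum_root_of_unity)
    show "(fourier_root N ^ (i + 1)) ^ N = 1"
      using i by (simp only: fourier_root_power_power_self)
    \<comment> \<open>Injectivity is applied to the exponents \<open>i + 1\<close> and
      \<open>0\<close>, both below \<open>N\<close>. The all-one row would have exponent
      \<open>0\<close> and a nonzero sum.\<close>
    show "fourier_root N ^ (i + 1) \<noteq> 1"
      using inj_onD[OF inj_on_fourier_root_power[of N], of "i + 1" 0] i
      by (auto simp: less_diff_conv simp del: power_Suc)
  qed
  finally show "(compensated_fourier_mat N \<theta> *\<^sub>v steering_vec N \<theta>) $ i = 0\<^sub>v (N - 1) $ i"
    using i by simp
qed (simp add: compensated_fourier_mat_def)

lemma mat_rank_compensated_fourier_mat:
  "mat_rank (compensated_fourier_mat N \<theta>) = N - 1"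
proof -
  let ?w = "fourier_root N" and ?z = "exp (- (\<i> * of_real \<theta>))"
  \<comment> \<open>The conjugate transpose divided by \<open>N\<close>: all entries have modulus 1,
    so conjugates can be written as inverses and cancel algebraically.\<close>
  define B where "B = mat N (N - 1)
    (\<lambda>(n, j). inverse (of_nat N) * inverse (?w ^ ((j + 1) * n) * ?z ^ n))"
  have "compensated_fourier_mat N \<theta> * B = 1\<^sub>m (N - 1)"
  proof (rule eq_matI)
    fix i j assume "i < dim_row (1\<^sub>m (N - 1) :: complex mat)" "j < dim_col (1\<^sub>m (N - 1) :: complex mat)"
    then have i: "i < N - 1" and j: "j < N - 1" by simp_all
    \<comment> \<open>The ratio of the roots belonging to rows \<open>i\<close> and
      \<open>j\<close>. The powers of \<open>?z\<close> cancel in the product of the two rows, so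
      only powers of \<open>x\<close> remain.\<close>
    define x where "x = ?w ^ (i + 1) * inverse (?w ^ (j + 1))"
    have "?w ^ (a * n) * ?z ^ n * (inverse (of_nat N) * inverse (?w ^ (b * n) * ?z ^ n))
        = inverse (of_nat N) * (?w ^ a * inverse (?w ^ b)) ^ n" for a b n
      by (simp add: power_mult power_mult_distrib power_inverse field_simps fourier_root_nonzero)
    note entry = this[of "i + 1" _ "j + 1", folded x_def]
    have "(compensated_fourier_mat N \<theta> * B) $$ (i, j) =
        (\<Sum>n<N. ?w ^ ((i + 1) * n) * ?z ^ n * (inverse (of_nat N) * inverse (?w ^ ((j + 1) * n) * ?z ^ n)))"
      using i j by (simp add: compensated_fourier_mat_def B_def scalar_prod_def lessThan_atLeast0)
    also have "\<dots> = inverse (of_nat N) * (\<Sum>n<N. x ^ n)"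
      unfolding entry by (simp add: sum_distrib_left)
    also have "\<dots> = (if i = j then 1 else 0)"
    proof (cases "i = j")
      case True
      have "x = 1"
        unfolding x_def True by (rule right_inverse) (simp add: fourier_root_nonzero)
      then show ?thesis using True i by simp
    next
      case False
      \<comment> \<open>Both exponents lie between 1 and \<open>N - 1\<close>, so distinct rows have
        distinct roots and \<open>x\<close> differs from 1.\<close>
      have "?w ^ (i + 1) \<noteq> ?w ^ (j + 1)"
        using inj_onD[OF inj_on_fourier_root_power[of N], of "i + 1" "j + 1"] i j False
        by (auto simp: less_diff_conv simp del: power_Suc)
      then have "x \<noteq> 1"
        by (simp add: x_def field_simps fourier_root_nonzero del: power_Suc)
      moreover have "x ^ N = 1"
        unfolding x_def power_mult_distrib power_inverse
        using i by (simp only: fourier_root_power_power_self) simp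
      ultimately show ?thesis
        using False by (simp add: geometric_sum_root_of_unity)
    qed
    finally show "(compensated_fourier_mat N \<theta> * B) $$ (i, j) = 1\<^sub>m (N - 1) $$ (i, j)"
      using i j by simp
  qed (simp_all add: compensated_fourier_mat_def B_def)
  moreover have "B \<in> carrier_mat N (N - 1)"
    by (simp add: B_def)
  ultimately have "vec_space.rank (N - 1) (compensated_fourier_mat N \<theta>) = N - 1"
    using vec_space.rank_eq_n_if_right_inverse compensated_fourier_mat_carrier by blast
  then show ?thesis
    by (simp add: mat_rank_def compensated_fourier_mat_def)
qed

lemma feasible_compensated_fourier_mat: "feasible N \<theta> (compensated_fourier_mat N \<theta>)"
  unfolding feasible_def
  using compensated_fourier_mat_carrier[of N \<theta>] mat_rank_compensated_fourier_mat[of N \<theta>]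
    compensated_fourier_mult_steering[of N \<theta>]
  by (auto simp: compensated_fourier_mat_def norm_mult norm_power cmod_fourier_root)

lemma feasible_mat_rank_less:
  assumes "feasible N \<theta> S" and "N > 0"
  shows "mat_rank S < N"
proof -
  \<comment> \<open>The entry at index 0 witnesses that the kernel vector prescribed by feasibility
    is nonzero.\<close>
  have "steering_vec N \<theta> $ 0 = 1"
    using assms(2) by (simp add: steering_vec_def)
  then have "steering_vec N \<theta> \<noteq> 0\<^sub>v N"
    using assms(2) by auto
  moreover have "steering_vec N \<theta> \<in> carrier_vec N"
    by (simp add: steering_vec_def)
  moreover have "S \<in> carrier_mat (dim_row S) N" "S *\<^sub>v steering_vec N \<theta> = 0\<^sub>v (dim_row S)"
    using assms(1) by (auto simp: feasible_def)
  ultimately show ?thesis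
    unfolding mat_rank_def by (intro vec_space.rank_less_if_kernel_nonzero)
qed

theorem proposition1:
  fixes N :: nat and \<theta> :: real
  assumes "N \<ge> 2"
  shows "truncated_fourier_mat N * phase_comp_mat N \<theta> =
           mat (N - 1) N (\<lambda>(i, n). fourier_root N ^ ((i + 1) * n) * exp (- (\<i> * of_real \<theta>)) ^ n) \<and>
         is_arg_max mat_rank (feasible N \<theta>) (truncated_fourier_mat N * phase_comp_mat N \<theta>)"
proof
  show "truncated_fourier_mat N * phase_comp_mat N \<theta> =
      mat (N - 1) N (\<lambda>(i, n). fourier_root N ^ ((i + 1) * n) * exp (- (\<i> * of_real \<theta>)) ^ n)"
    by (simp add: truncated_fourier_mult_phase_comp compensated_fourier_mat_def)
  show "is_arg_max mat_rank (feasible N \<theta>) (truncated_fourier_mat N * phase_comp_mat N \<theta>)"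
    \<comment> \<open>The attained value becomes \<open>N - 1\<close>; a feasible matrix of larger
      rank would have rank at least \<open>N\<close>, against the strict bound.\<close>
    unfolding truncated_fourier_mult_phase_comp is_arg_max_def mat_rank_compensated_fourier_mat
    using feasible_compensated_fourier_mat feasible_mat_rank_less assms by fastforce
qed

end
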